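(* Regardless of the feature value of the input, any translation vector that is scaled by $k\geq 0$ and added to a one-hot categorical input can alternatively be expressed with the first $m$ rules of a sequence. That is, let $\delta=(\delta_1,\dots,\delta_n)\in\mathbb{R}^n$ be any translation vector, and let $\Delta_i$ be the index of the $i$-th smallest value among $\delta_1,\dots,\delta_n$, so that $\Delta_1=\arg\min_i\delta_i$ and $\Delta_n=\arg\max_i\delta_i=:\Delta$. Consider the sequence of rules "If $\Delta_1$, Then $\Delta$", "If $\Delta_2$, Then $\Delta$", $\dots$, "If $\Delta_{n-1}$, Then $\Delta$", which depends only on $\delta$. Then for every scalar $k\ge 0$ there is an $m\in\{0,1,\dots,n-1\}$ such that the effect of adding $k\delta$ to a one-hot input, whatever its feature value, is expressed by the first $m$ rules of this sequence (no rules if $m=0$).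
   Context: A categorical feature with values $1,\dots,n$ is one-hot encoded as a vector $f=(f_1,\dots,f_n)\in\{0,1\}^n$ with exactly one entry equal to $1$; the feature value of the input is $F=\arg\max_i f_i$. Adding the scaled translation $k\delta$ gives $g=f+k\delta$, which is re-encoded by selecting its largest entry, so the feature value after translation is $G=\arg\max_i g_i$. Each $\arg\max$ or $\arg\min$ denotes the index of the largest or smallest entry and is written as a single index. A rule "If $a$, Then $b$" means that inputs with feature value $a$ are changed to feature value $b$; inputs with a feature value for which there is no rule are left unchanged. A translation is expressed by a set of rules if applying the rules gives the same change of feature value as adding the translation and re-encoding. *)

theory Defs
  imports "HOL-Analysis.Analysis"
begin

text \<open>
  The feature values $1, \dots, n$ are the elements of a finite linearly ordered type \<open>'n\<close>
  with \<open>n = CARD('n)\<close>. The order serves only to break ties, which makes arg max and arg min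
  single-valued. Among equal entries the one with the smaller index ranks as the larger, so
  arg max takes the smallest index at which the maximum is attained and arg min the largest
  index at which the minimum is attained. The same ranking orders the indices by their entries
  in \<open>delta_seq\<close>; its last element is then arg max and its first is arg min, also for vectors
  with repeated entries. Since \<open>'n\<close> is an arbitrary finite linear order, every fixed priority
  among the indices is covered.
\<close>

definition argmax :: "real ^ 'n::{finite,linorder} \<Rightarrow> 'n" where
  "argmax v = Min {i. \<forall>j. v $ j \<le> v $ i}"

definition argmin :: "real ^ 'n::{finite,linorder} \<Rightarrow> 'n" where
  "argmin v = Max {i. \<forall>j. v $ i \<le> v $ j}"

definition one_hot :: "real ^ 'n \<Rightarrow> bool" where
  "one_hot f \<longleftrightarrow> (\<forall>i. f $ i \<in> {0, 1}) \<and> (\<exists>!i. f $ i = 1)"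

text \<open>
  \<open>delta_seq \<delta> i\<close> is $\Delta_i$ for $1 \le i \le n$. As \<open>sort_key\<close> is stable, sorting the
  decreasing list of all indices puts the larger index first among equal entries.
\<close>

definition delta_seq :: "real ^ 'n::{finite,linorder} \<Rightarrow> nat \<Rightarrow> 'n" where
  "delta_seq \<delta> i = sort_key (\<lambda>j. \<delta> $ j) (rev (sorted_list_of_set UNIV)) ! (i - 1)"

text \<open>
  The pair \<open>(a, b)\<close> is the rule "If \<open>a\<close>, Then \<open>b\<close>". All rules are matched against the feature
  value of the original input; rules are not chained.
\<close>

type_synonym 'n rule = "'n \<times> 'n"

definition apply_rules :: "'n rule list \<Rightarrow> 'n \<Rightarrow> 'n" where
  "apply_rules rs a = (case map_of rs a of None \<Rightarrow> a | Some b \<Rightarrow> b)"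

definition rule_seq :: "real ^ 'n::{finite,linorder} \<Rightarrow> 'n rule list" where
  "rule_seq \<delta> = map (\<lambda>i. (delta_seq \<delta> i, argmax \<delta>)) [1..<CARD('n)]"

definition expressed_by :: "real ^ 'n::{finite,linorder} \<Rightarrow> 'n rule list \<Rightarrow> bool" where
  "expressed_by t rs \<longleftrightarrow> (\<forall>f. one_hot f \<longrightarrow> argmax (f + t) = apply_rules rs (argmax f))"

end

theory Submission
  imports Defs
begin

text \<open>
  Adding \<open>k\<delta>\<close> to the one-hot vector of \<open>a\<close> leaves only two candidates for the largest entry,
  namely \<open>a\<close> itself and \<open>\<Delta> = argmax \<delta>\<close>, since \<open>\<Delta>\<close> beats every other index already in \<open>\<delta>\<close>.
  The value changes iff \<open>1 + k\<delta>\<^sub>a\<close> loses against \<open>k\<delta>\<^sub>\<Delta>\<close>. This condition is inherited by all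
  indices ranked below \<open>a\<close>, also under the tie-breaking order, so the values that change
  form an initial segment of \<open>\<Delta>\<^sub>1, \<Delta>\<^sub>2, \<dots>\<close>, which does not reach \<open>\<Delta>\<^sub>n = \<Delta>\<close>.
\<close>

text \<open>The strict linear order behind all tie-breaking conventions: \<open>argmax v\<close> is
  its greatest element, \<open>argmin v\<close> its least, and \<open>ranking v\<close> lists it
  increasingly.\<close>

definition prec :: "real ^ 'n::{finite,linorder} \<Rightarrow> 'n \<Rightarrow> 'n \<Rightarrow> bool" where
  "prec v i j \<longleftrightarrow> v $ i < v $ j \<or> v $ i = v $ j \<and> j < i"

lemma prec_asym: "prec v i j \<Longrightarrow> \<not> prec v j i"
  by (auto simp: prec_def)

lemma prec_argmax:
  assumes "j \<noteq> argmax v"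
  shows "prec v j (argmax v)"
proof -
  let ?M = "{i. \<forall>j. v $ j \<le> v $ i}"
  have "Max (range (($) v)) \<in> range (($) v)"
    by (rule Max_in) auto
  then obtain i where "v $ i = Max (range (($) v))"
    by (metis rangeE)
  then have "i \<in> ?M"
    by auto
  then have "argmax v \<in> ?M"
    unfolding argmax_def by (intro Min_in) auto
  moreover have "argmax v < j" if "j \<in> ?M"
    using Min_le[of ?M j] that assms by (simp add: argmax_def order.strict_iff_order)
  ultimately show ?thesis
    by (cases "v $ j = v $ argmax v") (auto simp: prec_def less_le)
qed

lemma prec_argmin:
  assumes "j \<noteq> argmin v"
  shows "prec v (argmin v) j"
proof -
  let ?M = "{i. \<forall>j. v $ i \<le> v $ j}"
  have "Min (range (($) v)) \<in> range (($) v)"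
    by (rule Min_in) auto
  then obtain i where "v $ i = Min (range (($) v))"
    by (metis rangeE)
  then have "i \<in> ?M"
    by auto
  then have "argmin v \<in> ?M"
    unfolding argmin_def by (intro Max_in) auto
  moreover have "j < argmin v" if "j \<in> ?M"
    using Max_ge[of ?M j] that assms by (simp add: argmin_def order.strict_iff_order)
  ultimately show ?thesis
    by (cases "v $ j = v $ argmin v") (auto simp: prec_def less_le)
qed

lemma argmax_eqI: "(\<And>j. j \<noteq> i \<Longrightarrow> prec v j i) \<Longrightarrow> argmax v = i"
  using prec_argmax prec_asym by metis

lemma argmin_eqI: "(\<And>j. j \<noteq> i \<Longrightarrow> prec v i j) \<Longrightarrow> argmin v = i"
  using prec_argmin prec_asym by metis

text \<open>\<open>insort_key\<close> places \<open>x\<close> in front of all entries with the same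
  key, so ties are ordered by \<open>Q x y\<close>. By induction this gives the stability of
  \<open>sort_key\<close>.\<close>

lemma sorted_wrt_insort_key:
  assumes "sorted_wrt (\<lambda>x y. f x < f y \<or> f x = f y \<and> Q x y) xs" "\<And>y. y \<in> set xs \<Longrightarrow> Q x y"
  shows "sorted_wrt (\<lambda>x y. f x < f y \<or> f x = f y \<and> Q x y) (insort_key f x xs)"
  using assms by (induction xs) (auto simp: set_insort_key order.order_iff_strict)

lemma sorted_wrt_sort_key:
  assumes "sorted_wrt Q xs"
  shows "sorted_wrt (\<lambda>x y. f x < f y \<or> f x = f y \<and> Q x y) (sort_key f xs)"
  using assms by (induction xs) (auto intro: sorted_wrt_insort_key)

definition ranking :: "real ^ 'n::{finite,linorder} \<Rightarrow> 'n list" where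
  "ranking v = sort_key (($) v) (rev (sorted_list_of_set UNIV))"

lemma set_ranking [simp]: "set (ranking v) = UNIV"
  by (simp add: ranking_def)

lemma length_ranking [simp]: "length (ranking (v :: real ^ 'n::{finite,linorder})) = CARD('n)"
  by (simp add: ranking_def)

lemma sorted_wrt_ranking: "sorted_wrt (prec v) (ranking v)"
proof -
  have "sorted_wrt (\<lambda>i j. j < i) (rev (sorted_list_of_set (UNIV :: 'a set)))"
    using strict_sorted_list_of_set by (simp add: sorted_wrt_rev)
  from sorted_wrt_sort_key[OF this] show ?thesis
    unfolding ranking_def prec_def[abs_def] .
qed

lemma delta_seq_ranking: "delta_seq v i = ranking v ! (i - 1)"
  by (simp add: delta_seq_def ranking_def)

lemma delta_seq_first: "delta_seq v 1 = argmin v"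
proof -
  obtain x xs where "ranking v = x # xs"
    using set_ranking[of v] by (cases "ranking v") auto
  then show ?thesis
    using sorted_wrt_ranking[of v] set_ranking[of v]
    by (auto simp: delta_seq_ranking set_eq_iff intro!: argmin_eqI[symmetric])
qed

lemma delta_seq_last:
  fixes v :: "real ^ 'n::{finite,linorder}"
  shows "delta_seq v CARD('n) = argmax v"
proof -
  obtain x xs where r: "ranking v = xs @ [x]"
    using set_ranking[of v] by (cases "ranking v" rule: rev_cases) auto
  then have "length xs = CARD('n) - 1"
    using length_ranking[of v] by simp
  with r show ?thesis
    using sorted_wrt_ranking[of v] set_ranking[of v]
    by (auto simp: delta_seq_ranking sorted_wrt_append set_eq_iff nth_append
        intro!: argmax_eqI[symmetric])
qed

text \<open>The bound on \<open>m\<close> reflects that \<open>ranking v\<close> has one entry more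
  than \<open>rule_seq v\<close>: its last, \<open>argmax v\<close>, gets no rule.\<close>

lemma take_rule_seq:
  fixes v :: "real ^ 'n::{finite,linorder}"
  assumes "m \<le> CARD('n) - 1"
  shows "take m (rule_seq v) = map (\<lambda>a. (a, argmax v)) (take m (ranking v))"
  using assms by (intro nth_equalityI) (auto simp: rule_seq_def delta_seq_ranking)

lemma apply_rules_const:
  "apply_rules (map (\<lambda>a. (a, b)) xs) a = (if a \<in> set xs then b else a)"
proof -
  have "map_of (map (\<lambda>a. (a, b)) xs) a = (if a \<in> set xs then Some b else None)"
    by (induction xs) auto
  then show ?thesis
    by (simp add: apply_rules_def)
qed

text \<open>Once \<open>P\<close> fails, it fails at all later entries, so \<open>takeWhile\<close>
  misses none that satisfies \<open>P\<close>.\<close>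

lemma set_takeWhile_downward_closed:
  assumes "sorted_wrt R xs" "\<And>x y. R x y \<Longrightarrow> P y \<Longrightarrow> P x"
  shows "set (takeWhile P xs) = {x \<in> set xs. P x}"
  using assms by (induction xs) auto

lemma one_hot_eq_axis: "one_hot f \<Longrightarrow> f = axis (argmax f) 1"
proof -
  assume "one_hot f"
  then obtain a where a: "f $ a = 1" "\<And>i. i \<noteq> a \<Longrightarrow> f $ i = 0"
    by (force simp: one_hot_def)
  then have "argmax f = a"
    by (intro argmax_eqI) (auto simp: prec_def)
  with a show ?thesis
    by (auto simp: vec_eq_iff axis_def)
qed

lemma argmax_axis_plus_scaled:
  assumes "k \<ge> 0"
  shows "argmax (axis a 1 + k *\<^sub>R v) =
    (if prec (axis a 1 + k *\<^sub>R v) a (argmax v) then argmax v else a)"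
\<comment> \<open>Scaling by 0 erases the order of \<open>v\<close>, so \<open>argmax v\<close> need
  not beat the other indices; but then the unit entry at \<open>a\<close> wins outright.\<close>
proof (cases "k = 0")
  case True
  then have "argmax (axis a 1 + k *\<^sub>R v) = a"
    by (intro argmax_eqI) (auto simp: prec_def axis_def)
  then show ?thesis
    using True by (auto simp: prec_def axis_def split: if_splits)
next
  case False
  let ?g = "axis a 1 + k *\<^sub>R v"
  have other: "prec ?g j (argmax v)" if "j \<noteq> a" "j \<noteq> argmax v" for j
  proof -
    have "k * v $ j < k * v $ argmax v \<or> k * v $ j = k * v $ argmax v \<and> argmax v < j"
      using prec_argmax[OF that(2)] assms False by (auto simp: prec_def)
    then show ?thesis
      using that(1) by (auto simp: prec_def axis_def)
  qed
  show ?thesis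
  proof (cases "argmax ?g \<in> {a, argmax v}")
    case True
    then show ?thesis
      using prec_argmax[of _ ?g] prec_asym[of ?g] by (metis empty_iff insert_iff)
  next
    case False
    \<comment> \<open>A third index as \<open>argmax ?g\<close> would lie below
      \<open>argmax v\<close> by \<open>other\<close>, although it is the greatest.\<close>
    then show ?thesis
      using other[of "argmax ?g"] prec_argmax[of "argmax v" ?g] prec_asym[of ?g] by auto
  qed
qed

lemma expressed_by_prefix:
  fixes v :: "real ^ 'n::{finite,linorder}"
  assumes "k \<ge> 0"
  shows "\<exists>m\<in>{0..CARD('n) - 1}. expressed_by (k *\<^sub>R v) (take m (rule_seq v))"
proof
  \<comment> \<open>\<open>P a\<close> says that \<open>a\<close> loses to \<open>argmax v\<close>
    after the translation; \<open>m\<close> will count all such values.\<close>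
  define P where "P a \<longleftrightarrow> prec (axis a 1 + k *\<^sub>R v) a (argmax v)" for a
  define m where "m = length (takeWhile P (ranking v))"
  have "P x" if "prec v x y" "P y" for x y
  proof -
    have "\<not> P (argmax v)"
      by (simp add: P_def prec_def)
    with that have y: "y \<noteq> argmax v"
      by auto
    have x: "x \<noteq> argmax v"
      using that(1) y prec_argmax prec_asym by metis
    have "k * v $ x \<le> k * v $ y"
      using that(1) assms by (auto simp: prec_def intro: mult_left_mono)
    \<comment> \<open>As \<open>x\<close> and \<open>y\<close> differ from \<open>argmax v\<close>,
      \<open>P\<close> compares \<open>1 + k * v $ x\<close> and \<open>1 + k * v $ y\<close> with
      the same entry \<open>k * v $ argmax v\<close>. The case \<open>k = 0\<close> contradicts
      \<open>P y\<close>; on a tie, the index order carries over from \<open>y\<close> to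
      \<open>x\<close>.\<close>
    then consider "k * v $ x < k * v $ y" | "k = 0" | "k * v $ x = k * v $ y" "y < x"
      using \<open>prec v x y\<close> unfolding prec_def by (metis less_le mult_left_cancel)
    then show ?thesis
      using that(2) x y by cases (auto simp: P_def prec_def axis_def)
  qed
  then have set: "set (takeWhile P (ranking v)) = {a. P a}"
    using set_takeWhile_downward_closed[OF sorted_wrt_ranking, of v P] by simp
  \<comment> \<open>\<open>argmax v\<close> cannot lose to itself, so the prefix is proper and the
    available \<open>n - 1\<close> rules suffice.\<close>
  have "argmax v \<in> set (ranking v) - set (takeWhile P (ranking v))"
    unfolding set by (simp add: P_def prec_def)
  then have "m < CARD('n)"
    using length_takeWhile_le[of P "ranking v"] takeWhile_eq_take[of P "ranking v"]
    unfolding m_def by (metis DiffD1 DiffD2 length_ranking nless_le take_all_iff order_refl)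
  then show m: "m \<in> {0..CARD('n) - 1}"
    by auto
  have "take m (rule_seq v) = map (\<lambda>a. (a, argmax v)) (takeWhile P (ranking v))"
    using m by (simp add: take_rule_seq m_def flip: takeWhile_eq_take)
  then have "apply_rules (take m (rule_seq v)) a = argmax (axis a 1 + k *\<^sub>R v)" for a
    using argmax_axis_plus_scaled[OF assms, of a v] by (simp add: apply_rules_const set P_def)
  then show "expressed_by (k *\<^sub>R v) (take m (rule_seq v))"
    unfolding expressed_by_def using one_hot_eq_axis by metis
qed

theorem theorem4p2:
  fixes \<delta> :: "real ^ 'n::{finite,linorder}"
  shows "delta_seq \<delta> 1 = argmin \<delta> \<and> delta_seq \<delta> CARD('n) = argmax \<delta> \<and>
    (\<forall>k::real. k \<ge> 0 \<longrightarrow>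
      (\<exists>m\<in>{0..CARD('n) - 1}. expressed_by (k *\<^sub>R \<delta>) (take m (rule_seq \<delta>))))"
  using delta_seq_first delta_seq_last expressed_by_prefix by blast

end
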